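(* Let $f:\mathbb{R}^n\to\mathbb{R}^n$ be a convex monotone homogeneous map that has an eigenvector. Then, for all $k\ge1$, $\mathscr{G}^{c}(f^k)=\mathscr{G}^{c}(f)^k$; in particular $N^{c}(f^k)=N^{c}(f)$.
   Context: $\leq$ is the entrywise order of $\mathbb{R}^n$ and $\lambda+x=(\lambda+x_1,\dots,\lambda+x_n)$. A map $f$ is monotone if $x\le y\Rightarrow f(x)\le f(y)$, (additively) homogeneous if $f(\lambda+x)=\lambda+f(x)$ for all $\lambda\in\mathbb{R}$, and convex if each coordinate is convex. An eigenvector is $v\in\mathbb{R}^n$ with $f(v)=\lambda+v$ for some $\lambda\in\mathbb{R}$. $f^k$ is the $k$-th iterate of $f$ (also convex, monotone, homogeneous, with an eigenvector). For a directed graph $\mathscr{G}$, $\mathscr{G}^k$ is the graph with the same nodes as $\mathscr{G}$ and an arc $i\to j$ when there is a directed path of length $k$ from $i$ to $j$ in $\mathscr{G}$. Critical graph of a convex monotone homogeneous map $g$ with an eigenvector $v$: $\partial g(v)=\{P\in\mathbb{R}^{n\times n}\mid g(x)-g(v)\ge P(x-v)\ \forall x\}$, whose elements are stochastic matrices. For a stochastic matrix $P$, $\mathscr{G}(P)$ is the directed graph on $\{1,\dots,n\}$ with arcs $i\to j$ when $P_{ij}\neq0$; its classes are the equivalence classes for mutual accessibility (each node has access to itself), a class is final if no node in it has access to a node outside it, and $\mathscr{G}^{f}(P)$ is the restriction of $\mathscr{G}(P)$ to the union of the final classes. Then $\mathscr{G}^{c}(g)=\bigcup_{P\in\partial g(v)}\mathscr{G}^{f}(P)$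 (union of node sets and arc sets); it does not depend on the choice of the eigenvector $v$. $N^{c}(g)$ is the set of nodes of $\mathscr{G}^{c}(g)$. *)

theory Defs
  imports "HOL-Analysis.Analysis" "Graph_Theory.Digraph_Component"
begin

definition additively_homogeneous :: "(real^'n \<Rightarrow> real^'n) \<Rightarrow> bool" where
  "additively_homogeneous f \<longleftrightarrow> (\<forall>c x. f (vec c + x) = vec c + f x)"

definition coordinatewise_convex :: "(real^'n \<Rightarrow> real^'n) \<Rightarrow> bool" where
  "coordinatewise_convex f \<longleftrightarrow> (\<forall>i. convex_on UNIV (\<lambda>x. f x $ i))"

definition eigenvector :: "(real^'n \<Rightarrow> real^'n) \<Rightarrow> real^'n \<Rightarrow> bool" where
  "eigenvector f v \<longleftrightarrow> (\<exists>c. f v = vec c + v)"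

definition subdifferential :: "(real^'n \<Rightarrow> real^'n) \<Rightarrow> real^'n \<Rightarrow> (real^'n^'n) set" where
  "subdifferential g v = {P. \<forall>x. g x - g v \<ge> P *v (x - v)}"

definition matrix_graph :: "real^'n^'n \<Rightarrow> 'n pair_pre_digraph" where
  "matrix_graph P = \<lparr>pverts = UNIV, parcs = {(i, j). P $ i $ j \<noteq> 0}\<rparr>"

definition classes :: "'a pair_pre_digraph \<Rightarrow> 'a set set" where
  "classes G = pre_digraph.scc_of (with_proj G) ` pverts G"

definition final_class :: "'a pair_pre_digraph \<Rightarrow> 'a set \<Rightarrow> bool" where
  "final_class G C \<longleftrightarrow>
     C \<in> classes G \<and> (\<forall>i\<in>C. \<forall>j. i \<rightarrow>\<^sup>*\<^bsub>with_proj G\<^esub> j \<longrightarrow> j \<in> C)"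

definition final_nodes :: "'a pair_pre_digraph \<Rightarrow> 'a set" where
  "final_nodes G = \<Union>{C. final_class G C}"

definition final_graph :: "real^'n^'n \<Rightarrow> 'n pair_pre_digraph" where
  "final_graph P =
     (let G = matrix_graph P; N = final_nodes G
      in \<lparr>pverts = N, parcs = {(i, j) \<in> parcs G. i \<in> N \<and> j \<in> N}\<rparr>)"

text \<open>
  The eigenvector \<open>v\<close> is an argument. The critical graph of a convex monotone homogeneous
  map is the same for all its eigenvectors, so statements about it are made for every choice
  of eigenvector.
\<close>

definition critical_graph :: "(real^'n \<Rightarrow> real^'n) \<Rightarrow> real^'n \<Rightarrow> 'n pair_pre_digraph" where
  "critical_graph g v =
     \<lparr>pverts = (\<Union>P\<in>subdifferential g v. pverts (final_graph P)),
      parcs = (\<Union>P\<in>subdifferential g v. parcs (final_graph P))\<rparr>"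

abbreviation critical_nodes :: "(real^'n \<Rightarrow> real^'n) \<Rightarrow> real^'n \<Rightarrow> 'n set" where
  "critical_nodes g v \<equiv> pverts (critical_graph g v)"

text \<open>Paths may repeat nodes and arcs: a circuit of length \<open>k\<close> gives loops in the \<open>k\<close>-th power.\<close>

definition graph_power :: "'a pair_pre_digraph \<Rightarrow> nat \<Rightarrow> 'a pair_pre_digraph" where
  "graph_power G k =
     \<lparr>pverts = pverts G,
      parcs = {(i, j). \<exists>p. pre_digraph.awalk (with_proj G) i p j \<and> length p = k}\<rparr>"

lemma vec_add_add: "(vec a :: real^'n) + (vec b + x) = vec (a + b) + x"
  by (simp add: vec_eq_iff)

lemma eigenvector_funpow:
  assumes "additively_homogeneous f" "eigenvector f v"
  shows "eigenvector (f ^^ k) v"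
proof (induction k)
  case 0
  show ?case unfolding eigenvector_def by (rule exI[of _ 0]) (simp add: vec_eq_iff)
next
  case (Suc k)
  then obtain c where c: "(f ^^ k) v = vec c + v"
    unfolding eigenvector_def by blast
  obtain d where d: "f v = vec d + v"
    using assms(2) unfolding eigenvector_def by blast
  have "(f ^^ Suc k) v = vec (c + d) + v"
    using assms(1) by (simp add: c d additively_homogeneous_def vec_add_add)
  then show ?case unfolding eigenvector_def by blast
qed

end

theory Submission
  imports Defs
begin

text \<open>
  Averaging rows of subgradients unites their supports, so any family of rows whose arcs can all be
  undone by paths of the family is realized, with all its nodes recurrent, by a single subgradient.
  In particular one \<open>M \<in> \<partial>f(v)\<close> has the critical graph of \<open>f\<close> as its final graph;
  \<open>M\<^sup>k\<close> is then a subgradient of \<open>f\<^sup>k\<close>, which gives one inclusion.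
  For the other, the chain rule (from a separating hyperplane) unrolls each recurrent row of a
  subgradient \<open>R\<close> of \<open>f\<^sup>k\<close> into rows of \<open>\<partial>f(v)\<close> used along paths of length \<open>k\<close>. Every
  such path can be continued through the final class of \<open>R\<close> back to its start, so the rows used
  form a family as above.
\<close>

section \<open>Recurrent nodes of a relation\<close>

text \<open>Markov chain terminology: for the support of a matrix these are the nodes of the final
  classes, by \<open>final_nodes_matrix_graph\<close>, so that later arguments concern paths instead
  of classes.\<close>

definition recurrent :: "'a rel \<Rightarrow> 'a \<Rightarrow> bool" where
  "recurrent E i \<longleftrightarrow> (\<forall>j. (i, j) \<in> E\<^sup>* \<longrightarrow> (j, i) \<in> E\<^sup>*)"

lemma recurrentD: "recurrent E i \<Longrightarrow> (i, j) \<in> E\<^sup>* \<Longrightarrow> (j, i) \<in> E\<^sup>*"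
  by (simp add: recurrent_def)

lemma recurrent_reachable:
  assumes "recurrent E i" "(i, j) \<in> E\<^sup>*"
  shows "recurrent E j"
  using assms unfolding recurrent_def by (meson rtrancl_trans)

lemma recurrent_restrict:
  assumes "recurrent E i" "(i, j) \<in> E\<^sup>*"
  shows "(i, j) \<in> (E \<inter> {s. recurrent E s} \<times> UNIV)\<^sup>*"
  using assms(2)
proof (induction rule: rtrancl_induct)
  case (step y z)
  then show ?case
    using recurrent_reachable[OF assms(1)] by (auto intro: rtrancl_into_rtrancl)
qed simp

text \<open>A local test: arcs do not leave \<open>S\<close>, so returns along single arcs compose
  to a return along a whole path.\<close>

lemma recurrentI_arcs:
  assumes ret: "\<And>s t. s \<in> S \<Longrightarrow> (s, t) \<in> E \<Longrightarrow> t \<in> S \<and> (t, s) \<in> E\<^sup>*"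
    and "i \<in> S"
  shows "recurrent E i"
  unfolding recurrent_def
proof (intro allI impI)
  fix j assume "(i, j) \<in> E\<^sup>*"
  then have "j \<in> S \<and> (j, i) \<in> E\<^sup>*"
  proof (induction rule: rtrancl_induct)
    case (step y z)
    then show ?case using ret[of y z] by (meson rtrancl_trans)
  qed (use \<open>i \<in> S\<close> in simp)
  then show "(j, i) \<in> E\<^sup>*" ..
qed

lemma relpow_mult: "((E ^^ k) ^^ m) = (E ^^ (k * m) :: 'a rel)"
  by (induction m) (simp_all add: relpow_add[symmetric] add.commute)

lemma relpow_loop: "(i, i) \<in> E \<Longrightarrow> (i, i) \<in> (E ^^ n :: 'a rel)"
  by (induction n) auto

lemma relpow_mono: "E \<subseteq> F \<Longrightarrow> E ^^ k \<subseteq> (F ^^ k :: 'a rel)"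
  by (induction k) auto

text \<open>A return path of length \<open>l\<close> is completed to a length divisible by \<open>k\<close> by running
  \<open>k - 1\<close> further times around the resulting circuit.\<close>
lemma recurrent_relpow:
  assumes "recurrent E i" "k \<ge> 1"
  shows "recurrent (E ^^ k) i"
  unfolding recurrent_def
proof (intro allI impI)
  fix j assume "(i, j) \<in> (E ^^ k)\<^sup>*"
  then obtain m where ij: "(i, j) \<in> E ^^ (k * m)"
    by (metis rtrancl_imp_relpow relpow_mult)
  then have "(j, i) \<in> E\<^sup>*" using recurrentD[OF assms(1)] relpow_imp_rtrancl by blast
  then obtain l where ji: "(j, i) \<in> E ^^ l" using rtrancl_imp_relpow by blast
  have "(i, i) \<in> E ^^ (k * m + l)" using ij ji by (auto simp: relpow_add)
  then have "(i, i) \<in> (E ^^ (k * m + l)) ^^ (k - 1)"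
    by (rule relpow_loop)
  then have "(j, i) \<in> E ^^ (l + (k * m + l) * (k - 1))"
    unfolding relpow_add[of l] relpow_mult using ji by blast
  moreover have "l + (k * m + l) * (k - 1) = k * (l + m * (k - 1))"
    using assms(2) by (cases k) (auto simp: algebra_simps)
  ultimately show "(j, i) \<in> (E ^^ k)\<^sup>*"
    by (metis relpow_mult relpow_imp_rtrancl)
qed

section \<open>Critical graphs in terms of recurrent nodes\<close>

definition support :: "real^'n^'n \<Rightarrow> 'n rel" where
  "support P = {(i, j). P $ i $ j \<noteq> 0}"

lemma support_iff [simp]: "(i, j) \<in> support P \<longleftrightarrow> P $ i $ j \<noteq> 0"
  by (simp add: support_def)

lemma recurrent_support_step:
  assumes "recurrent (support P) i" "P $ i $ j \<noteq> 0"
  shows "recurrent (support P) j"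
  using assms(1) by (rule recurrent_reachable) (use assms(2) in auto)

text \<open>Supplies the return paths that \<open>recurrent_family\<close> asks for. They only use
  rows at recurrent nodes, which are the rows that get collected or unrolled later.\<close>

lemma recurrent_support_return:
  assumes "recurrent (support P) i" "P $ i $ j \<noteq> 0"
  shows "(j, i) \<in> (support P \<inter> {s. recurrent (support P) s} \<times> UNIV)\<^sup>*"
proof (rule recurrent_restrict)
  show "recurrent (support P) j" using assms by (rule recurrent_support_step)
  have "(i, j) \<in> (support P)\<^sup>*" using assms(2) by auto
  then show "(j, i) \<in> (support P)\<^sup>*" by (rule recurrentD[OF assms(1)])
qed

text \<open>Every index is a vertex, so vertex-restricted reachability is plain reachability. A
  class is final exactly when its members are recurrent.\<close>

lemma final_nodes_matrix_graph:
  "final_nodes (matrix_graph P) = {i. recurrent (support P) i}"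
proof -
  have reach: "i \<rightarrow>\<^sup>*\<^bsub>with_proj (matrix_graph P)\<^esub> j \<longleftrightarrow> (i, j) \<in> (support P)\<^sup>*" for i j
  proof
    assume "i \<rightarrow>\<^sup>*\<^bsub>with_proj (matrix_graph P)\<^esub> j"
    then show "(i, j) \<in> (support P)\<^sup>*"
      by (auto dest!: reachable_rtranclI simp: matrix_graph_def support_def)
  next
    assume "(i, j) \<in> (support P)\<^sup>*"
    then show "i \<rightarrow>\<^sup>*\<^bsub>with_proj (matrix_graph P)\<^esub> j"
      by (induction rule: rtrancl_induct)
        (auto simp: reachable_def matrix_graph_def support_def intro: rtrancl_on_into_rtrancl_on)
  qed
  have classes: "classes (matrix_graph P)
      = range (\<lambda>u. {v. (u, v) \<in> (support P)\<^sup>* \<and> (v, u) \<in> (support P)\<^sup>*})"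
    by (simp add: classes_def pre_digraph.scc_of_def reach) (simp add: matrix_graph_def)
  show ?thesis
  proof (intro equalityI subsetI)
    fix i assume "i \<in> final_nodes (matrix_graph P)"
    \<comment> \<open>\<open>u\<close> is the representative of the final class that contains
      \<open>i\<close>.\<close>
    then obtain u where "(u, i) \<in> (support P)\<^sup>*" "(i, u) \<in> (support P)\<^sup>*"
      "\<forall>j. (i, j) \<in> (support P)\<^sup>* \<longrightarrow> (j, u) \<in> (support P)\<^sup>*"
      by (auto simp: final_nodes_def final_class_def reach classes)
    then show "i \<in> {i. recurrent (support P) i}"
      by (auto simp: recurrent_def intro: rtrancl_trans)
  next
    fix i assume i: "i \<in> {i. recurrent (support P) i}"
    let ?C = "{v. (i, v) \<in> (support P)\<^sup>* \<and> (v, i) \<in> (support P)\<^sup>*}"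
    have "final_class (matrix_graph P) ?C"
      unfolding final_class_def reach classes
      using i by (auto simp: recurrent_def intro: rtrancl_trans)
    then show "i \<in> final_nodes (matrix_graph P)"
      unfolding final_nodes_def by blast
  qed
qed

lemma pverts_final_graph: "pverts (final_graph P) = {i. recurrent (support P) i}"
  by (simp add: final_graph_def Let_def final_nodes_matrix_graph)

lemma parcs_final_graph:
  "parcs (final_graph P) = {(i, j). recurrent (support P) i \<and> P $ i $ j \<noteq> 0}"
  by (auto simp: final_graph_def Let_def final_nodes_matrix_graph dest: recurrent_support_step)
    (auto simp: matrix_graph_def)

lemma pverts_critical_graph:
  "pverts (critical_graph g v) = {i. \<exists>P\<in>subdifferential g v. recurrent (support P) i}"
  by (auto simp: critical_graph_def pverts_final_graph)

lemma parcs_critical_graph: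
  "parcs (critical_graph g v)
    = {(i, j). \<exists>P\<in>subdifferential g v. recurrent (support P) i \<and> P $ i $ j \<noteq> 0}"
  by (auto simp: critical_graph_def parcs_final_graph)

lemma parcs_critical_graph_subset:
  "parcs (critical_graph g v) \<subseteq> pverts (critical_graph g v) \<times> pverts (critical_graph g v)"
  by (auto simp: pverts_critical_graph parcs_critical_graph dest: recurrent_support_step)

lemma parcs_graph_power:
  assumes "parcs G \<subseteq> pverts G \<times> pverts G" "k \<ge> 1"
  shows "parcs (graph_power G k) = parcs G ^^ k"
proof -
  have walk: "(\<exists>p. set p \<subseteq> parcs G \<and> pcas i p j \<and> length p = m) \<longleftrightarrow> (i, j) \<in> parcs G ^^ m"
    for i j m
  proof (induction m arbitrary: i)
    case (Suc m)
    have "(\<exists>p. set p \<subseteq> parcs G \<and> pcas i p j \<and> length p = Suc m)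
      \<longleftrightarrow> (\<exists>l. (i, l) \<in> parcs G \<and> (\<exists>p. set p \<subseteq> parcs G \<and> pcas l p j \<and> length p = m))"
      by (fastforce simp: length_Suc_conv intro: exI[of _ "(i, _) # _"])
    also have "\<dots> \<longleftrightarrow> (i, j) \<in> parcs G ^^ Suc m"
      unfolding Suc.IH by (metis relpow_Suc_D2 relpow_Suc_I2)
    finally show ?case .
  qed auto
  \<comment> \<open>\<open>awalk\<close> requires the start to be a vertex; for
    \<open>k \<ge> 1\<close> the first arc shows this, whereas the power 0 also relates non-vertices
    to themselves.\<close>
  have "i \<in> pverts G" if "(i, j) \<in> parcs G ^^ k" for i j
    using that assms
    by (cases k) (auto simp del: relpow.simps dest!: relpow_Suc_D2)
  then have "(\<exists>p. i \<in> pverts G \<and> set p \<subseteq> parcs G \<and> pcas i p j \<and> length p = k)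
      \<longleftrightarrow> (i, j) \<in> parcs G ^^ k" for i j
    using walk[of i j k] by blast
  then show ?thesis
    by (simp add: graph_power_def pre_digraph.awalk_def cas_with_proj_eq)
qed

lemma pverts_graph_power [simp]: "pverts (graph_power G k) = pverts G"
  by (simp add: graph_power_def)

section \<open>Powers of nonnegative matrices\<close>

fun mat_power :: "real^'n^'n \<Rightarrow> nat \<Rightarrow> real^'n^'n" where
  "mat_power M 0 = mat 1"
| "mat_power M (Suc k) = M ** mat_power M k"

text \<open>Nonnegative summands cannot cancel, so an entry of a product vanishes only if all its
  terms do.\<close>

lemma support_mat_power:
  assumes nonneg: "\<And>i j. M $ i $ j \<ge> (0::real)"
  shows "support (mat_power M k) = support M ^^ k"
proof -
  have pos: "mat_power M k $ i $ j \<ge> 0" for k i j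
    by (induction k arbitrary: i j) (auto simp: mat_def matrix_matrix_mult_def nonneg intro!: sum_nonneg)
  have "mat_power M k $ i $ j \<noteq> 0 \<longleftrightarrow> (i, j) \<in> support M ^^ k" for i j
  proof (induction k arbitrary: i)
    case 0
    then show ?case by (simp add: mat_def)
  next
    case (Suc k)
    have "mat_power M (Suc k) $ i $ j \<noteq> 0
        \<longleftrightarrow> (\<exists>l. M $ i $ l * mat_power M k $ l $ j \<noteq> 0)"
      by (simp add: matrix_matrix_mult_def sum_nonneg_eq_0_iff nonneg pos)
    also have "\<dots> \<longleftrightarrow> (\<exists>l. (i, l) \<in> support M \<and> (l, j) \<in> support M ^^ k)"
      using Suc.IH by simp
    also have "\<dots> \<longleftrightarrow> (i, j) \<in> support M ^^ Suc k"
      by (metis relpow_Suc_D2 relpow_Suc_I2)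
    finally show ?case .
  qed
  then show ?thesis by auto
qed

section \<open>Subgradients\<close>

text \<open>The infimum of \<open>F x u\<close> over \<open>x\<close> is convex in \<open>u\<close>.
  Its strict epigraph \<open>?A\<close> misses \<open>(0, c)\<close>, and a separating hyperplane
  provides the slope \<open>p\<close>.\<close>

lemma marginal_subgradient:
  fixes F :: "'a::real_vector \<Rightarrow> 'b::euclidean_space \<Rightarrow> real"
  assumes convex: "\<And>x u y w a b. a \<ge> 0 \<Longrightarrow> b \<ge> 0 \<Longrightarrow> a + b = 1 \<Longrightarrow>
      F (a *\<^sub>R x + b *\<^sub>R y) (a *\<^sub>R u + b *\<^sub>R w) \<le> a * F x u + b * F y w"
    and bound: "\<And>x. F x 0 \<ge> c"
  shows "\<exists>p. \<forall>x u. F x u \<ge> c + p \<bullet> u"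
proof -
  let ?A = "{(u, t). \<exists>x. F x u < t}"
  have "convex ?A"
    unfolding convex_def
  proof (intro ballI allI impI)
    fix z1 z2 :: "'b \<times> real" and a b :: real
    assume "z1 \<in> ?A" "z2 \<in> ?A" and ab: "0 \<le> a" "0 \<le> b" "a + b = 1"
    then obtain x u s y w t where z: "z1 = (u, s)" "z2 = (w, t)" and lt: "F x u < s" "F y w < t"
      by auto
    have "a * F x u + b * F y w < a * s + b * t"
    proof (cases "a = 0")
      case False
      then have "a * F x u < a * s" using ab lt by simp
      then show ?thesis using ab lt by (intro add_less_le_mono) (auto intro: mult_left_mono)
    qed (use ab lt in simp)
    with convex[OF ab, of x y u w] have "F (a *\<^sub>R x + b *\<^sub>R y) (a *\<^sub>R u + b *\<^sub>R w) < a * s + b * t"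
      by simp
    then show "a *\<^sub>R z1 + b *\<^sub>R z2 \<in> ?A"
      by (auto simp: z)
  qed
  moreover have "(0, F undefined 0 + 1) \<in> ?A" by auto (rule exI[of _ undefined], simp)
  then have "?A \<noteq> {}" by blast
  moreover have "{(0, c)} \<inter> ?A = {}" using bound by (auto simp: not_less)
  ultimately obtain d \<beta> where nz: "d \<noteq> 0" and lo: "d \<bullet> (0, c) \<le> \<beta>"
    and hi: "\<And>z. z \<in> ?A \<Longrightarrow> d \<bullet> z \<ge> \<beta>"
    using separating_hyperplane_sets[of "{(0, c)}" ?A] by auto
  obtain a b where d: "d = (a, b)" by fastforce
  have sep: "a \<bullet> u + b * t \<ge> b * c" if "F x u < t" for x u t
  proof -
    have "(u, t) \<in> ?A" using that by blast
    from hi[OF this] show ?thesis using lo unfolding d by (simp add: inner_Pair)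
  qed
  \<comment> \<open>\<open>?A\<close> is unbounded upwards; a height above both
    \<open>F undefined 0\<close> and \<open>c\<close> excludes \<open>b < 0\<close>.\<close>
  have "b \<ge> 0"
  proof (rule ccontr)
    assume "\<not> b \<ge> 0"
    moreover have "b * c \<le> b * (\<bar>F undefined 0\<bar> + \<bar>c\<bar> + 1)"
      using sep[of undefined 0 "\<bar>F undefined 0\<bar> + \<bar>c\<bar> + 1"] by auto
    ultimately show False by (auto simp: mult_le_cancel_left)
  qed
  \<comment> \<open>\<open>F\<close> is finite everywhere, so \<open>?A\<close> has points above
    every \<open>u\<close> and the hyperplane cannot be vertical.\<close>
  moreover have "b \<noteq> 0"
  proof
    assume "b = 0"
    then have "a \<bullet> (- a) \<ge> 0" using sep[of undefined "- a" "F undefined (- a) + 1"] by simp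
    then have "a = 0" by (metis inner_ge_zero inner_minus_right inner_eq_zero_iff neg_0_le_iff_le order_antisym)
    with nz d \<open>b = 0\<close> show False by (simp add: zero_prod_def)
  qed
  ultimately have b: "b > 0" by simp
  \<comment> \<open>\<open>sep\<close> holds only strictly above \<open>F x u\<close>, hence the
    slack \<open>e\<close>.\<close>
  have "F x u \<ge> c + (- a /\<^sub>R b) \<bullet> u" for x u
  proof (rule field_le_epsilon)
    fix e :: real assume "e > 0"
    then have "a \<bullet> u + b * (F x u + e) \<ge> b * c" by (intro sep[of x]) simp
    with b show "c + (- a /\<^sub>R b) \<bullet> u \<le> F x u + e" by (simp add: field_simps)
  qed
  then show ?thesis by blast
qed

definition row_subdiff :: "(real^'n \<Rightarrow> real^'n) \<Rightarrow> 'n \<Rightarrow> real^'n \<Rightarrow> (real^'n) set" where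
  "row_subdiff f i v = {p. \<forall>x. p \<bullet> (x - v) \<le> f x $ i - f v $ i}"

lemma row_subdiffD: "p \<in> row_subdiff f i v \<Longrightarrow> p \<bullet> (x - v) \<le> f x $ i - f v $ i"
  by (simp add: row_subdiff_def)

text \<open>The subdifferential is a product over rows, so rows of different subgradients can be
  combined into a new one.\<close>

lemma subdifferential_iff: "P \<in> subdifferential f v \<longleftrightarrow> (\<forall>i. P $ i \<in> row_subdiff f i v)"
  by (auto simp: subdifferential_def row_subdiff_def less_eq_vec_def matrix_vector_mul_component)

lemma convex_row_subdiff: "convex (row_subdiff f i v)"
  unfolding convex_def row_subdiff_def
proof safe
  fix p q :: "real^'a" and a b :: real and x
  assume "\<forall>x. p \<bullet> (x - v) \<le> f x $ i - f v $ i" "\<forall>x. q \<bullet> (x - v) \<le> f x $ i - f v $ i"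
    and ab: "0 \<le> a" "0 \<le> b" "a + b = 1"
  then have "a * (p \<bullet> (x - v)) + b * (q \<bullet> (x - v)) \<le> a * (f x $ i - f v $ i) + b * (f x $ i - f v $ i)"
    by (intro add_mono mult_left_mono) auto
  also have "\<dots> = f x $ i - f v $ i" using ab by (simp flip: distrib_right)
  finally show "(a *\<^sub>R p + b *\<^sub>R q) \<bullet> (x - v) \<le> f x $ i - f v $ i"
    by (simp add: inner_add_left)
qed

section \<open>Subgradient rows of convex monotone homogeneous maps\<close>

locale convex_monotone_homogeneous =
  fixes f :: "real^'n \<Rightarrow> real^'n"
  assumes convex: "coordinatewise_convex f" and mono: "mono f"
    and homogeneous: "additively_homogeneous f"
begin

lemma f_convex:
  assumes "a \<ge> 0" "b \<ge> 0" "a + b = 1"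
  shows "f (a *\<^sub>R x + b *\<^sub>R y) \<le> a *\<^sub>R f x + b *\<^sub>R f y"
  using convex assms by (auto simp: coordinatewise_convex_def convex_on_def less_eq_vec_def)

lemma f_vec_add: "f (vec c + x) = vec c + f x"
  using homogeneous by (simp add: additively_homogeneous_def)

lemma row_subdiff_nonneg:
  assumes "p \<in> row_subdiff f i v"
  shows "p $ j \<ge> 0"
proof -
  have "p \<bullet> (v - axis j 1 - v) \<le> f (v - axis j 1) $ i - f v $ i"
    by (rule row_subdiffD[OF assms])
  moreover have "f (v - axis j 1) \<le> f v"
    by (rule monoD[OF mono]) (auto simp: less_eq_vec_def axis_def)
  ultimately show ?thesis by (auto simp: less_eq_vec_def inner_axis dest: spec[of _ i])
qed

text \<open>Homogeneity makes \<open>f\<close> linear in constant directions; testing with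
  \<open>c\<close> and \<open>- c\<close> gives equality. So rows sum to 1.\<close>

lemma row_subdiff_inner_vec:
  assumes "p \<in> row_subdiff f i v"
  shows "p \<bullet> vec c = c"
proof -
  have le: "p \<bullet> vec c \<le> c" for c
    using row_subdiffD[OF assms, of "vec c + v"] by (simp add: f_vec_add)
  have "p \<bullet> vec (- c) = - (p \<bullet> vec c)" by (simp add: inner_vec_def sum_negf)
  with le[of c] le[of "- c"] show ?thesis by simp
qed

lemma row_subdiff_nonzero:
  assumes "p \<in> row_subdiff f i v"
  shows "\<exists>j. p $ j \<noteq> 0"
  using row_subdiff_inner_vec[OF assms, of 1] by (auto simp: inner_vec_def intro: ccontr)

text \<open>Lets rows at \<open>v\<close> serve at \<open>(f ^^ k) v\<close>, which is a translate
  of \<open>v\<close> by a constant.\<close>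

lemma row_subdiff_vec_add: "row_subdiff f i (vec c + v) = row_subdiff f i v"
proof -
  have "(\<forall>x. p \<bullet> (x - (vec c + v)) \<le> f x $ i - f (vec c + v) $ i)
      \<longleftrightarrow> (\<forall>x. p \<bullet> (x - v) \<le> f x $ i - f v $ i)" (is "?L \<longleftrightarrow> ?R") for p
  proof
    show ?R if ?L
    proof
      fix x show "p \<bullet> (x - v) \<le> f x $ i - f v $ i"
        using spec[OF that, of "vec c + x"] by (simp add: f_vec_add)
    qed
    show ?L if ?R
    proof
      fix x
      have "f x = vec c + f (x - vec c)" using f_vec_add[of c "x - vec c"] by simp
      then show "p \<bullet> (x - (vec c + v)) \<le> f x $ i - f (vec c + v) $ i"
        using spec[OF that, of "x - vec c"] by (simp add: f_vec_add inner_diff_right inner_add_right)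
    qed
  qed
  then show ?thesis by (simp add: row_subdiff_def)
qed

lemma row_subdiff_nonempty: "row_subdiff f i v \<noteq> {}"
proof -
  \<comment> \<open>The real \<open>x\<close> is a dummy: nothing is minimized out here.\<close>
  have "\<exists>p. \<forall>(x::real) u. f (v + u) $ i \<ge> f v $ i + p \<bullet> u"
  proof (rule marginal_subgradient)
    fix a b :: real and u w :: "real^'n"
    assume ab: "a \<ge> 0" "b \<ge> 0" "a + b = 1"
    have "v + (a *\<^sub>R u + b *\<^sub>R w) = a *\<^sub>R (v + u) + b *\<^sub>R (v + w)"
      using ab by (simp add: algebra_simps flip: scaleR_add_left)
    then show "f (v + (a *\<^sub>R u + b *\<^sub>R w)) $ i \<le> a * f (v + u) $ i + b * f (v + w) $ i"
      using f_convex[OF ab, of "v + u" "v + w"] by (simp add: less_eq_vec_def)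
  qed simp
  then obtain p where p: "\<And>u. f (v + u) $ i \<ge> f v $ i + p \<bullet> u" by blast
  have "p \<in> row_subdiff f i v"
    unfolding row_subdiff_def using p[of "x - v" for x] by (force simp: algebra_simps)
  then show ?thesis by blast
qed

text \<open>The map \<open>g\<close> is perturbed coordinate by coordinate, each \<open>g\<^sub>j\<close> being evaluated at its own
  point \<open>x + U\<^sub>j\<close>, and the argument of \<open>f\<close> is perturbed by \<open>u\<close>. A subgradient of the marginal
  function then yields the row \<open>p\<close> and the products \<open>p\<^sub>j Q\<^sub>j\<close> at once.\<close>
lemma row_subdiff_comp:
  assumes g: "convex_monotone_homogeneous g"
    and r: "r \<in> row_subdiff (\<lambda>x. f (g x)) i v"
  shows "\<exists>p\<in>row_subdiff f i (g v). \<exists>Q\<in>subdifferential g v. r = p v* Q"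
proof -
  interpret g: convex_monotone_homogeneous g by fact
  define F where "F x U = f ((\<chi> j. g (x + snd U $ j) $ j) + fst U) $ i - r \<bullet> (x - v)"
    for x :: "real^'n" and U :: "(real^'n) \<times> (real^'n^'n)"
  have "\<exists>p. \<forall>x U. F x U \<ge> f (g v) $ i + p \<bullet> U"
  proof (rule marginal_subgradient)
    fix x y :: "real^'n" and U V :: "(real^'n) \<times> (real^'n^'n)" and a b :: real
    assume ab: "a \<ge> 0" "b \<ge> 0" "a + b = 1"
    let ?z = "\<lambda>x U. (\<chi> j. g (x + snd U $ j) $ j) + fst U :: real^'n"
    have "g (a *\<^sub>R x + b *\<^sub>R y + (a *\<^sub>R snd U $ j + b *\<^sub>R snd V $ j)) $ j
        \<le> a * g (x + snd U $ j) $ j + b * g (y + snd V $ j) $ j" for j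
      using g.f_convex[OF ab, of "x + snd U $ j" "y + snd V $ j"]
      by (simp add: less_eq_vec_def algebra_simps)
    then have "?z (a *\<^sub>R x + b *\<^sub>R y) (a *\<^sub>R U + b *\<^sub>R V) \<le> a *\<^sub>R ?z x U + b *\<^sub>R ?z y V"
      by (simp add: less_eq_vec_def algebra_simps)
    then have "f (?z (a *\<^sub>R x + b *\<^sub>R y) (a *\<^sub>R U + b *\<^sub>R V)) \<le> f (a *\<^sub>R ?z x U + b *\<^sub>R ?z y V)"
      by (rule monoD[OF mono])
    also have "\<dots> \<le> a *\<^sub>R f (?z x U) + b *\<^sub>R f (?z y V)" by (rule f_convex[OF ab])
    finally have "f (?z (a *\<^sub>R x + b *\<^sub>R y) (a *\<^sub>R U + b *\<^sub>R V)) $ i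
        \<le> a * f (?z x U) $ i + b * f (?z y V) $ i"
      by (simp add: less_eq_vec_def)
    moreover have "a *\<^sub>R x + b *\<^sub>R y - v = a *\<^sub>R (x - v) + b *\<^sub>R (y - v)"
      using ab by (simp add: algebra_simps flip: scaleR_add_left)
    then have "r \<bullet> (a *\<^sub>R x + b *\<^sub>R y - v) = a * (r \<bullet> (x - v)) + b * (r \<bullet> (y - v))"
      by (simp add: inner_add_right)
    ultimately show "F (a *\<^sub>R x + b *\<^sub>R y) (a *\<^sub>R U + b *\<^sub>R V) \<le> a * F x U + b * F y V"
      unfolding F_def by (simp add: right_diff_distrib)
  next
    fix x
    show "f (g v) $ i \<le> F x 0"
      using row_subdiffD[OF r, of x] by (simp add: F_def)
  qed
  \<comment> \<open>The subgradient is split into its part \<open>p\<close> for the perturbation of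
    the argument of \<open>f\<close> and its part \<open>W\<close> for the shifts inside
    \<open>g\<close>.\<close>
  then obtain p W where pW: "\<And>x u U. F x (u, U) \<ge> f (g v) $ i + p \<bullet> u + W \<bullet> U"
    by (auto simp: inner_Pair add.assoc)
  have p: "p \<in> row_subdiff f i (g v)"
    unfolding row_subdiff_def
  proof safe
    fix y
    show "p \<bullet> (y - g v) \<le> f y $ i - f (g v) $ i"
      using pW[where x = v and u = "y - g v" and U = 0] by (simp add: F_def)
  qed
  have W: "W $ j \<bullet> d \<le> p $ j * (g (v + d) $ j - g v $ j)" for j d
  proof -
    \<comment> \<open>\<open>?U\<close> shifts only the evaluation point of coordinate
      \<open>j\<close>, by \<open>d\<close>; \<open>?u\<close> compensates, so that \<open>f\<close>
      is still evaluated at \<open>g v\<close>.\<close>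
    let ?U = "(\<chi> l. if l = j then d else 0) :: real^'n^'n"
    let ?u = "axis j (g v $ j - g (v + d) $ j) :: real^'n"
    have "(\<chi> l. g (v + ?U $ l) $ l) + ?u = g v" by (simp add: vec_eq_iff axis_def)
    then have "f (g v) $ i \<ge> f (g v) $ i + p \<bullet> ?u + W \<bullet> ?U"
      using pW[where x = v and u = ?u and U = ?U] by (simp add: F_def)
    moreover have "W \<bullet> ?U = W $ j \<bullet> d"
      unfolding inner_vec_def[of W] by (simp add: if_distrib cong: if_cong)
    ultimately show ?thesis by (simp add: inner_axis algebra_simps)
  qed
  have sum_W: "r = (\<Sum>j\<in>UNIV. W $ j)"
  proof -
    \<comment> \<open>Moving \<open>x\<close> to \<open>v - d\<close> and shifting every coordinate
      back by \<open>d\<close> leaves \<open>f (g v)\<close> and only changes the linear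
      term.\<close>
    have "r \<bullet> d \<ge> (\<Sum>j\<in>UNIV. W $ j) \<bullet> d" for d
      using pW[where x = "v - d" and u = 0 and U = "\<chi> j. d"]
      by (simp add: F_def inner_vec_def[of W] inner_sum_left)
    from this[of "(\<Sum>j\<in>UNIV. W $ j) - r"] have "((\<Sum>j\<in>UNIV. W $ j) - r) \<bullet> ((\<Sum>j\<in>UNIV. W $ j) - r) \<le> 0"
      by (simp add: inner_diff_left)
    then show ?thesis by (metis eq_iff_diff_eq_0 inner_eq_zero_iff inner_ge_zero order_antisym)
  qed
  \<comment> \<open>Where \<open>p $ j = 0\<close>, the bound on \<open>W\<close> forces
    \<open>W $ j = 0\<close>, so any subgradient row will do there.\<close>
  define Q where "Q = (\<chi> j. if p $ j = 0 then SOME q. q \<in> row_subdiff g j v else W $ j /\<^sub>R p $ j)"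
  have "Q \<in> subdifferential g v"
    unfolding subdifferential_iff
  proof
    fix j
    show "Q $ j \<in> row_subdiff g j v"
    proof (cases "p $ j = 0")
      case True
      then show ?thesis using g.row_subdiff_nonempty[of j v] by (auto simp: Q_def some_in_eq)
    next
      case False
      then have "p $ j > 0" using row_subdiff_nonneg[OF p, of j] by simp
      then show ?thesis
        using W[of j "x - v" for x] by (auto simp: Q_def row_subdiff_def field_simps)
    qed
  qed
  moreover have "W $ j = p $ j *\<^sub>R Q $ j" for j
  proof (cases "p $ j = 0")
    case True
    then have "W $ j \<bullet> W $ j \<le> 0" using W[of j "W $ j"] by simp
    then show ?thesis using True by (metis inner_eq_zero_iff inner_ge_zero order_antisym scale_zero_left)
  qed (simp add: Q_def)
  then have "r = p v* Q"
    unfolding sum_W by (simp add: vec_eq_iff vector_matrix_mult_def mult.commute)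
  ultimately show ?thesis using p by blast
qed

end

section \<open>Assembling subgradients from recurrent families of rows\<close>

text \<open>Midpoints of nonnegative vectors unite supports. The convex set \<open>?B\<close> bounds
  the support from above; an induction over indices reaches all of it.\<close>

lemma convex_hull_full_support:
  fixes W :: "(real^'n) set"
  assumes nonneg: "\<And>p j. p \<in> W \<Longrightarrow> p $ j \<ge> 0" and "W \<noteq> {}"
  shows "\<exists>q\<in>convex hull W. \<forall>j. q $ j \<noteq> 0 \<longleftrightarrow> (\<exists>p\<in>W. p $ j \<noteq> 0)"
proof -
  let ?S = "{j. \<exists>p\<in>W. p $ j \<noteq> 0}"
  let ?B = "{q :: real^'n. (\<forall>j. q $ j \<ge> 0) \<and> (\<forall>j. q $ j \<noteq> 0 \<longrightarrow> j \<in> ?S)}"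
  have "convex ?B"
  proof (rule convexI)
    fix x y :: "real^'n" and a b :: real
    assume xy: "x \<in> ?B" "y \<in> ?B" "0 \<le> a" "0 \<le> b" "a + b = 1"
    have "j \<in> ?S" if "(a *\<^sub>R x + b *\<^sub>R y) $ j \<noteq> 0" for j
    proof -
      have "x $ j \<noteq> 0 \<or> y $ j \<noteq> 0" using that by auto
      then show ?thesis using xy by blast
    qed
    then have "\<forall>j. (a *\<^sub>R x + b *\<^sub>R y) $ j \<noteq> 0 \<longrightarrow> j \<in> ?S" by (intro allI impI)
    moreover have "\<forall>j. (a *\<^sub>R x + b *\<^sub>R y) $ j \<ge> 0" using xy by simp
    ultimately show "a *\<^sub>R x + b *\<^sub>R y \<in> ?B" by (intro CollectI conjI)
  qed
  moreover have "W \<subseteq> ?B" using nonneg by blast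
  ultimately have hull: "convex hull W \<subseteq> ?B" by (intro hull_minimal)
  have "finite T \<Longrightarrow> T \<subseteq> ?S \<Longrightarrow> \<exists>q\<in>convex hull W. \<forall>j\<in>T. q $ j \<noteq> 0" for T
  proof (induction T rule: finite_induct)
    case empty
    obtain p where "p \<in> W" using \<open>W \<noteq> {}\<close> by blast
    then have "p \<in> convex hull W" by (rule hull_inc)
    then show ?case by blast
  next
    case (insert t T)
    then obtain q p where q: "q \<in> convex hull W" "\<forall>j\<in>T. q $ j \<noteq> 0" and p: "p \<in> W" "p $ t \<noteq> 0"
      by auto
    let ?m = "(1/2) *\<^sub>R q + (1/2) *\<^sub>R p"
    have "?m \<in> convex hull W"
      by (rule convexD[OF convex_convex_hull]) (use q p in \<open>auto intro: hull_inc\<close>)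
    moreover have "?m $ j \<noteq> 0" if "j \<in> insert t T" for j
    proof -
      have "q $ j \<ge> 0" "p $ j \<ge> 0" using q p hull nonneg by auto
      moreover have "q $ j \<noteq> 0 \<or> p $ j \<noteq> 0" using that q p by auto
      ultimately show ?thesis by auto
    qed
    ultimately show ?case by blast
  qed
  from this[of ?S] obtain q where "q \<in> convex hull W" "\<forall>j\<in>?S. q $ j \<noteq> 0" by auto
  then show ?thesis using hull by blast
qed

text \<open>A set of pairs, not a matrix, because one node may carry several rows.\<close>

definition row_arcs :: "('n \<times> (real^'n)) set \<Rightarrow> 'n rel" where
  "row_arcs U = {(s, t). \<exists>p. (s, p) \<in> U \<and> p $ t \<noteq> 0}"

text \<open>Iterating the chain rule writes a row \<open>r\<close> of a subgradient of \<open>f ^^ k\<close> as a randomized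
  \<open>k\<close>-step strategy started at \<open>i\<close>; \<open>U\<close> collects the rows that it uses on the way.\<close>
definition unrolls :: "('n \<times> (real^'n)) set \<Rightarrow> nat \<Rightarrow> 'n \<Rightarrow> real^'n \<Rightarrow> bool" where
  "unrolls U k i r \<longleftrightarrow>
     (\<forall>s t. (s, t) \<in> row_arcs U \<longrightarrow>
        (i, s) \<in> (row_arcs U)\<^sup>* \<and> (\<exists>j. r $ j \<noteq> 0 \<and> (t, j) \<in> (row_arcs U)\<^sup>*))
     \<and> (\<forall>j. r $ j \<noteq> 0 \<longrightarrow> (i, j) \<in> row_arcs U ^^ k)
     \<and> (k \<ge> 1 \<longrightarrow> i \<in> fst ` U)"

lemma row_arcs_mono: "U \<subseteq> V \<Longrightarrow> row_arcs U \<subseteq> row_arcs V"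
  by (auto simp: row_arcs_def)

context convex_monotone_homogeneous
begin

text \<open>Averaging the rows at each node makes the support there equal to the arcs of
  \<open>U\<close>; nodes without rows receive an arbitrary subgradient row.\<close>

lemma recurrent_family:
  assumes rows: "\<And>s p. (s, p) \<in> U \<Longrightarrow> p \<in> row_subdiff f s v"
    and ret: "\<And>s t. (s, t) \<in> row_arcs U \<Longrightarrow> (t, s) \<in> (row_arcs U)\<^sup>*"
  shows "\<exists>Q\<in>subdifferential f v. row_arcs U \<subseteq> support Q
    \<and> (\<forall>s\<in>fst ` U. recurrent (support Q) s)"
proof -
  define W where "W s = {p. (s, p) \<in> U}" for s
  have "\<exists>q\<in>row_subdiff f s v. W s \<noteq> {} \<longrightarrow> (\<forall>j. q $ j \<noteq> 0 \<longleftrightarrow> (s, j) \<in> row_arcs U)" for s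
  proof (cases "W s = {}")
    case True
    then show ?thesis using row_subdiff_nonempty by blast
  next
    case False
    have sub: "W s \<subseteq> row_subdiff f s v" using rows by (auto simp: W_def)
    then have "\<exists>q\<in>convex hull (W s). \<forall>j. q $ j \<noteq> 0 \<longleftrightarrow> (\<exists>p\<in>W s. p $ j \<noteq> 0)"
      using False row_subdiff_nonneg by (intro convex_hull_full_support) auto
    moreover have "convex hull (W s) \<subseteq> row_subdiff f s v"
      using sub convex_row_subdiff by (rule hull_minimal)
    ultimately show ?thesis by (fastforce simp: row_arcs_def W_def)
  qed
  then obtain q where q: "\<And>s. q s \<in> row_subdiff f s v"
    and qs: "\<And>s j. W s \<noteq> {} \<Longrightarrow> q s $ j \<noteq> 0 \<longleftrightarrow> (s, j) \<in> row_arcs U"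
    by metis
  define Q where "Q = (\<chi> s. q s)"
  have Q: "Q \<in> subdifferential f v" by (simp add: subdifferential_iff Q_def q)
  have arcs: "row_arcs U \<subseteq> support Q"
  proof
    fix a assume "a \<in> row_arcs U"
    then show "a \<in> support Q"
      using qs[of "fst a" "snd a"] by (cases a) (auto simp: Q_def row_arcs_def W_def)
  qed
  have dom: "s \<in> fst ` U \<longleftrightarrow> W s \<noteq> {}" for s by (force simp: W_def)
  have "recurrent (support Q) s" if "s \<in> fst ` U" for s
  proof (rule recurrentI_arcs[OF _ that])
    fix s t assume s: "s \<in> fst ` U" and "(s, t) \<in> support Q"
    then have "(s, t) \<in> row_arcs U" using qs[of s t] by (simp add: dom Q_def)
    then have ts: "(t, s) \<in> (row_arcs U)\<^sup>*" by (rule ret)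
    \<comment> \<open>The return path is empty, with \<open>t = s\<close>, or its first arc shows
      that \<open>t\<close> carries a row.\<close>
    then have "t \<in> fst ` U"
      by (cases rule: converse_rtranclE) (use s in \<open>force simp: row_arcs_def\<close>)+
    moreover have "(t, s) \<in> (support Q)\<^sup>*" using ts rtrancl_mono[OF arcs] by blast
    ultimately show "t \<in> fst ` U \<and> (t, s) \<in> (support Q)\<^sup>*" ..
  qed
  with Q arcs show ?thesis by blast
qed

text \<open>The recurrent rows of all subgradients form a family with exactly the critical arcs;
  each arc is undone inside the matrix that supplied it.\<close>

lemma critical_graph_realized:
  "\<exists>M\<in>subdifferential f v. parcs (critical_graph f v) \<subseteq> support M
    \<and> (\<forall>s\<in>pverts (critical_graph f v). recurrent (support M) s)"
proof -
  define U where "U = {(s, P $ s) | s P. P \<in> subdifferential f v \<and> recurrent (support P) s}"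
  have arcs: "row_arcs U = parcs (critical_graph f v)"
    by (auto simp: row_arcs_def U_def parcs_critical_graph)
  have dom: "fst ` U = pverts (critical_graph f v)"
    by (force simp: U_def pverts_critical_graph)
  have "\<exists>M\<in>subdifferential f v. row_arcs U \<subseteq> support M
    \<and> (\<forall>s\<in>fst ` U. recurrent (support M) s)"
  proof (rule recurrent_family)
    show "p \<in> row_subdiff f s v" if "(s, p) \<in> U" for s p
      using that by (auto simp: U_def subdifferential_iff)
    fix s t assume "(s, t) \<in> row_arcs U"
    then obtain P where P: "P \<in> subdifferential f v" "recurrent (support P) s" "P $ s $ t \<noteq> 0"
      by (auto simp: arcs parcs_critical_graph)
    then have "(t, s) \<in> (support P \<inter> {s. recurrent (support P) s} \<times> UNIV)\<^sup>*"
      by (intro recurrent_support_return)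
    moreover have "support P \<inter> {s. recurrent (support P) s} \<times> UNIV \<subseteq> row_arcs U"
      using P(1) by (auto simp: arcs parcs_critical_graph)
    ultimately show "(t, s) \<in> (row_arcs U)\<^sup>*" using rtrancl_mono by blast
  qed
  then show ?thesis by (simp add: arcs dom)
qed

section \<open>Independence of the eigenvector\<close>

text \<open>At an index maximizing \<open>w - v\<close>, the bound of \<open>w\<close> by a
  translate of \<open>v\<close> is tight; applying \<open>f\<close> compares the eigenvalues
  there.\<close>

lemma eigenvalue_le:
  assumes "f v = vec a + v" "f w = vec b + w"
  shows "b \<le> a"
proof -
  have "Max (range (($) (w - v))) \<in> range (($) (w - v))" by (rule Max_in) auto
  then obtain i where "Max (range (($) (w - v))) = (w - v) $ i" by (rule rangeE)
  then have i: "(w - v) $ j \<le> (w - v) $ i" for j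
    by (metis Max_ge finite_imageI finite rangeI)
  have "w \<le> vec ((w - v) $ i) + v" using i by (auto simp: less_eq_vec_def algebra_simps)
  then have "f w \<le> f (vec ((w - v) $ i) + v)" by (rule monoD[OF mono])
  then have "f w $ i \<le> (vec ((w - v) $ i) + f v) $ i" by (simp add: f_vec_add less_eq_vec_def)
  then show ?thesis by (simp add: assms)
qed

text \<open>By the minimum principle, the difference of two eigenvectors is constant along each final
  class, so the rows indexed by that class remain subgradients at the other eigenvector.\<close>
lemma critical_graph_subset:
  assumes "eigenvector f v" "eigenvector f w"
  shows "pverts (critical_graph f v) \<subseteq> pverts (critical_graph f w)"
    and "parcs (critical_graph f v) \<subseteq> parcs (critical_graph f w)"
proof -
  obtain a where fv: "f v = vec a + v" using assms(1) by (auto simp: eigenvector_def)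
  obtain b where fw: "f w = vec b + w" using assms(2) by (auto simp: eigenvector_def)
  have ab: "a = b" using eigenvalue_le[OF fv fw] eigenvalue_le[OF fw fv] by simp
  define z where "z = w - v"
  have transfer: "P $ i \<in> row_subdiff f i w"
    if P: "P \<in> subdifferential f v" and i: "recurrent (support P) i" for P i
  proof -
    have row: "P $ j \<in> row_subdiff f j v" for j using P by (simp add: subdifferential_iff)
    have mean: "P $ j \<bullet> (z - vec c) = P $ j \<bullet> z - c" for j c
      by (simp add: inner_diff_right row_subdiff_inner_vec[OF row])
    \<comment> \<open>Equal eigenvalues cancel, so \<open>z\<close> is superharmonic for
      \<open>P\<close>.\<close>
    have super: "P $ j \<bullet> z \<le> z $ j" for j
      using row_subdiffD[OF row, of j w] by (simp add: z_def fv fw ab)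
    let ?C = "{j. (i, j) \<in> (support P)\<^sup>*}"
    obtain m where m: "(i, m) \<in> (support P)\<^sup>*"
      and min: "\<And>j. (i, j) \<in> (support P)\<^sup>* \<Longrightarrow> z $ m \<le> z $ j"
      using finite_has_minimal[of "(\<lambda>j. z $ j) ` ?C"] by fastforce
    \<comment> \<open>Where the minimum is attained, the differences have nonnegative terms and a
      mean of at most 0, so the minimum passes to successors.\<close>
    have const: "z $ j = z $ m" if "(m, j) \<in> (support P)\<^sup>*" for j
      using that
    proof (induction rule: rtrancl_induct)
      case (step j k)
      have nonneg: "P $ j $ l * (z $ l - z $ m) \<ge> 0" for l
      proof (cases "P $ j $ l = 0")
        case False
        then have "(i, l) \<in> (support P)\<^sup>*" using m step(1)
          by (meson rtrancl_into_rtrancl rtrancl_trans support_iff)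
        then show ?thesis using min row_subdiff_nonneg[OF row] by simp
      qed simp
      have "(\<Sum>l\<in>UNIV. P $ j $ l * (z $ l - z $ m)) \<le> 0"
        using mean[of j "z $ m"] super[of j] step(3) by (simp add: inner_vec_def)
      then have "(\<Sum>l\<in>UNIV. P $ j $ l * (z $ l - z $ m)) = 0"
        by (intro order_antisym sum_nonneg nonneg)
      then have "P $ j $ k * (z $ k - z $ m) = 0"
        by (rule sum_nonneg_0[of UNIV "\<lambda>l. P $ j $ l * (z $ l - z $ m)" k, OF finite nonneg _ UNIV_I])
      then show ?case using step(2) by simp
    qed simp
    have "(m, i) \<in> (support P)\<^sup>*" using recurrentD[OF i m] .
    then have zi: "z $ i = z $ m" by (rule const)
    have "P $ i $ l * (z $ l - z $ i) = 0" for l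
    proof (cases "P $ i $ l = 0")
      case False
      then have "(m, l) \<in> (support P)\<^sup>*"
        by (intro rtrancl_into_rtrancl[OF \<open>(m, i) \<in> _\<close>]) simp
      then show ?thesis using const[of l] zi by simp
    qed simp
    then have "P $ i \<bullet> (z - vec (z $ i)) = 0"
      unfolding inner_vec_def by (intro sum.neutral ballI) simp
    then have "P $ i \<bullet> z = z $ i" using mean[of i "z $ i"] by simp
    \<comment> \<open>The subgradient inequality at \<open>v\<close> is tight at \<open>w\<close>,
      which moves the base point to \<open>w\<close>.\<close>
    then have "P $ i \<bullet> (w - v) = f w $ i - f v $ i" by (simp add: z_def fv fw ab)
    moreover have "P $ i \<bullet> (x - v) \<le> f x $ i - f v $ i" for x by (rule row_subdiffD[OF row])
    ultimately have "P $ i \<bullet> (x - w) \<le> f x $ i - f w $ i" for x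
      by (smt (verit) inner_diff_right)
    then show ?thesis by (simp add: row_subdiff_def)
  qed
  obtain M where M: "M \<in> subdifferential f v" "parcs (critical_graph f v) \<subseteq> support M"
    and rec: "\<And>s. s \<in> pverts (critical_graph f v) \<Longrightarrow> recurrent (support M) s"
    using critical_graph_realized by blast
  \<comment> \<open>Only recurrent rows are known to transfer to \<open>w\<close>;
    \<open>recurrent_family\<close> fills in the others.\<close>
  define U where "U = {(s, M $ s) | s. recurrent (support M) s}"
  have arcs: "row_arcs U = support M \<inter> {s. recurrent (support M) s} \<times> UNIV"
    by (auto simp: row_arcs_def U_def)
  have "\<exists>Q\<in>subdifferential f w. row_arcs U \<subseteq> support Q
    \<and> (\<forall>s\<in>fst ` U. recurrent (support Q) s)"
  proof (rule recurrent_family)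
    show "p \<in> row_subdiff f s w" if "(s, p) \<in> U" for s p
      using that transfer[OF M(1)] by (auto simp: U_def)
    fix s t assume "(s, t) \<in> row_arcs U"
    then have s: "recurrent (support M) s" "M $ s $ t \<noteq> 0" by (auto simp: arcs)
    then show "(t, s) \<in> (row_arcs U)\<^sup>*"
      unfolding arcs by (rule recurrent_support_return)
  qed
  then obtain Q where Q: "Q \<in> subdifferential f w" "row_arcs U \<subseteq> support Q"
    and recQ: "\<And>s. recurrent (support M) s \<Longrightarrow> recurrent (support Q) s"
    by (force simp: U_def)
  show "pverts (critical_graph f v) \<subseteq> pverts (critical_graph f w)"
    using rec recQ Q(1) by (auto simp: pverts_critical_graph[of f w])
  show "parcs (critical_graph f v) \<subseteq> parcs (critical_graph f w)"
  proof safe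
    fix s t assume st: "(s, t) \<in> parcs (critical_graph f v)"
    then have s: "recurrent (support M) s" using rec parcs_critical_graph_subset by blast
    then have "(s, t) \<in> support Q" using st M(2) Q(2) by (auto simp: arcs)
    then show "(s, t) \<in> parcs (critical_graph f w)"
      using Q(1) recQ[OF s] by (auto simp: parcs_critical_graph)
  qed
qed

lemma critical_graph_eigenvector_independent:
  assumes "eigenvector f v" "eigenvector f w"
  shows "critical_graph f v = critical_graph f w"
  using critical_graph_subset[OF assms] critical_graph_subset[OF assms(2,1)]
  by (intro pair_pre_digraph.equality) auto

section \<open>Iterates\<close>

lemma funpow_locale: "convex_monotone_homogeneous (f ^^ k)"
proof (induction k)
  case 0
  show ?case
    by unfold_locales (auto simp: coordinatewise_convex_def convex_on_def mono_def
        additively_homogeneous_def)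
next
  case (Suc k)
  interpret g: convex_monotone_homogeneous "f ^^ k" by fact
  show ?case
  proof
    show "mono (f ^^ Suc k)" using mono g.mono by (simp add: mono_def)
    show "additively_homogeneous (f ^^ Suc k)"
      by (simp add: additively_homogeneous_def f_vec_add g.f_vec_add)
    have "(f ^^ Suc k) (a *\<^sub>R x + b *\<^sub>R y) \<le> a *\<^sub>R (f ^^ Suc k) x + b *\<^sub>R (f ^^ Suc k) y"
      if ab: "a \<ge> 0" "b \<ge> 0" "a + b = 1" for a b x y
      using order_trans[OF monoD[OF mono g.f_convex[OF ab, of x y]] f_convex[OF ab]] by simp
    then show "coordinatewise_convex (f ^^ Suc k)"
      unfolding coordinatewise_convex_def convex_on_def less_eq_vec_def by simp
  qed
qed

lemma funpow_eigenvector: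
  assumes "eigenvector f v"
  shows "\<exists>c. (f ^^ k) v = vec c + v"
  using eigenvector_funpow[OF homogeneous assms] by (simp add: eigenvector_def)

text \<open>Nonnegative rows of \<open>M\<close> preserve the inequality for \<open>f ^^ k\<close>,
  and they are subgradient rows of \<open>f\<close> at \<open>(f ^^ k) v\<close> by
  translation.\<close>

lemma mat_power_subdifferential:
  assumes "eigenvector f v" "M \<in> subdifferential f v"
  shows "mat_power M k \<in> subdifferential (f ^^ k) v"
proof (induction k)
  case (Suc k)
  obtain c where c: "(f ^^ k) v = vec c + v" using funpow_eigenvector[OF assms(1)] by blast
  have row: "M $ i \<in> row_subdiff f i v" for i using assms(2) by (simp add: subdifferential_iff)
  have "M *v (mat_power M k *v (x - v)) \<le> (f ^^ Suc k) x - (f ^^ Suc k) v" for x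
    unfolding less_eq_vec_def
  proof
    fix i
    have "(M *v (mat_power M k *v (x - v))) $ i = M $ i \<bullet> (mat_power M k *v (x - v))"
      by (simp add: matrix_vector_mul_component)
    also have "\<dots> \<le> M $ i \<bullet> ((f ^^ k) x - (f ^^ k) v)"
      using Suc row_subdiff_nonneg[OF row]
      by (auto simp: inner_vec_def subdifferential_def less_eq_vec_def intro!: sum_mono mult_left_mono)
    also have "\<dots> \<le> f ((f ^^ k) x) $ i - f ((f ^^ k) v) $ i"
      using row[of i] unfolding c by (intro row_subdiffD) (simp add: row_subdiff_vec_add)
    finally show "(M *v (mat_power M k *v (x - v))) $ i \<le> ((f ^^ Suc k) x - (f ^^ Suc k) v) $ i"
      by simp
  qed
  then show ?case by (simp add: subdifferential_def matrix_vector_mul_assoc)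
qed (simp add: subdifferential_def)

lemma graph_power_subset:
  assumes "eigenvector f v" "k \<ge> 1"
  shows "pverts (critical_graph f v) \<subseteq> pverts (critical_graph (f ^^ k) v)"
    and "parcs (critical_graph f v) ^^ k \<subseteq> parcs (critical_graph (f ^^ k) v)"
proof -
  obtain M where M: "M \<in> subdifferential f v" "parcs (critical_graph f v) \<subseteq> support M"
    and rec: "\<And>s. s \<in> pverts (critical_graph f v) \<Longrightarrow> recurrent (support M) s"
    using critical_graph_realized by blast
  have row: "M $ i \<in> row_subdiff f i v" for i using M(1) by (simp add: subdifferential_iff)
  have supp: "support (mat_power M k) = support M ^^ k"
    by (rule support_mat_power) (rule row_subdiff_nonneg[OF row])
  have Mk: "mat_power M k \<in> subdifferential (f ^^ k) v"
    using assms(1) M(1) by (rule mat_power_subdifferential)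
  have reck: "recurrent (support (mat_power M k)) s" if "s \<in> pverts (critical_graph f v)" for s
    unfolding supp using rec[OF that] assms(2) by (rule recurrent_relpow)
  show "pverts (critical_graph f v) \<subseteq> pverts (critical_graph (f ^^ k) v)"
    using reck Mk by (auto simp: pverts_critical_graph[of "f ^^ k"])
  show "parcs (critical_graph f v) ^^ k \<subseteq> parcs (critical_graph (f ^^ k) v)"
  proof safe
    fix s t assume st: "(s, t) \<in> parcs (critical_graph f v) ^^ k"
    obtain l where "k = Suc l" using assms(2) by (cases k) auto
    then obtain s' where "(s, s') \<in> parcs (critical_graph f v)"
      using st relpow_Suc_D2 by metis
    then have "s \<in> pverts (critical_graph f v)" using parcs_critical_graph_subset by blast
    moreover have "(s, t) \<in> support (mat_power M k)"
      unfolding supp using st relpow_mono[OF M(2)] by blast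
    ultimately show "(s, t) \<in> parcs (critical_graph (f ^^ k) v)"
      using Mk reck unfolding parcs_critical_graph by auto
  qed
qed

text \<open>By induction: the chain rule gives \<open>r = p v* Q\<close>, and \<open>(i, p)\<close>
  is joined to the families of those rows of \<open>Q\<close> that \<open>p\<close> can
  reach.\<close>

lemma row_subdiff_funpow:
  assumes "eigenvector f v" "r \<in> row_subdiff (f ^^ k) i v"
  shows "\<exists>U. (\<forall>s p. (s, p) \<in> U \<longrightarrow> p \<in> row_subdiff f s v) \<and> unrolls U k i r"
  using assms(2)
proof (induction k arbitrary: i r)
  case 0
  \<comment> \<open>For the identity map, testing in directions that leave coordinate
    \<open>i\<close> fixed shows that \<open>r\<close> is supported at \<open>i\<close>; the empty
    family fits.\<close>
  have "r $ j = 0" if "j \<noteq> i" for j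
  proof -
    have "(axis j c :: real^'n) $ i = 0" for c using that by (simp add: axis_def)
    then have "r $ j * c \<le> 0" for c
      using row_subdiffD[OF 0, of "v + axis j c"] by (simp add: inner_axis)
    from this[of 1] this[of "-1"] show ?thesis by simp
  qed
  then have "j = i" if "r $ j \<noteq> 0" for j using that by blast
  then show ?case by (intro exI[of _ "{}"]) (auto simp: row_arcs_def unrolls_def)
next
  case (Suc k)
  interpret g: convex_monotone_homogeneous "f ^^ k" by (rule funpow_locale)
  obtain c where c: "(f ^^ k) v = vec c + v" using funpow_eigenvector[OF assms(1)] by blast
  have "r \<in> row_subdiff (\<lambda>x. f ((f ^^ k) x)) i v"
    using Suc.prems by (simp add: row_subdiff_def)
  then obtain p Q where p: "p \<in> row_subdiff f i v" and Q: "Q \<in> subdifferential (f ^^ k) v"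
    and r: "r = p v* Q"
    using row_subdiff_comp[OF funpow_locale, of r k i v] by (auto simp: c row_subdiff_vec_add)
  have Qrow: "Q $ t \<in> row_subdiff (f ^^ k) t v" for t using Q by (simp add: subdifferential_iff)
  \<comment> \<open>By nonnegativity, every two-step route through \<open>p\<close> and
    \<open>Q\<close> survives in \<open>r\<close>.\<close>
  have r_nz: "r $ j \<noteq> 0 \<longleftrightarrow> (\<exists>t. p $ t \<noteq> 0 \<and> Q $ t $ j \<noteq> 0)" for j
    using row_subdiff_nonneg[OF p] g.row_subdiff_nonneg[OF Qrow]
    by (simp add: r vector_matrix_mult_def sum_nonneg_eq_0_iff)
  obtain U where rows: "\<And>t s p. (s, p) \<in> U t \<Longrightarrow> p \<in> row_subdiff f s v"
    and U: "\<And>t. unrolls (U t) k t (Q $ t)"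
    using Suc.IH[OF Qrow] by metis
  have ret: "(t, s) \<in> (row_arcs (U t))\<^sup>* \<and> (\<exists>j. Q $ t $ j \<noteq> 0 \<and> (s', j) \<in> (row_arcs (U t))\<^sup>*)"
    if "(s, s') \<in> row_arcs (U t)" for t s s'
    using U[of t] that by (simp add: unrolls_def)
  have path: "(t, j) \<in> row_arcs (U t) ^^ k" if "Q $ t $ j \<noteq> 0" for t j
    using U[of t] that by (simp add: unrolls_def)
  define V where "V = insert (i, p) (\<Union>t\<in>{t. p $ t \<noteq> 0}. U t)"
  have first: "(i, t) \<in> row_arcs V" if "p $ t \<noteq> 0" for t
    using that by (auto simp: V_def row_arcs_def)
  have sub: "row_arcs (U t) \<subseteq> row_arcs V" if "p $ t \<noteq> 0" for t
    using that by (intro row_arcs_mono) (auto simp: V_def)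
  have arc_cases: "(s = i \<and> p $ t \<noteq> 0) \<or> (\<exists>l. p $ l \<noteq> 0 \<and> (s, t) \<in> row_arcs (U l))"
    if "(s, t) \<in> row_arcs V" for s t
    using that by (auto simp: V_def row_arcs_def)
  have "(i, s) \<in> (row_arcs V)\<^sup>* \<and> (\<exists>j. r $ j \<noteq> 0 \<and> (t, j) \<in> (row_arcs V)\<^sup>*)"
    if "(s, t) \<in> row_arcs V" for s t
    using arc_cases[OF that]
  proof (elim disjE conjE exE)
    assume "s = i" and t: "p $ t \<noteq> 0"
    obtain j where j: "Q $ t $ j \<noteq> 0" using g.row_subdiff_nonzero[OF Qrow] by blast
    have "(t, j) \<in> (row_arcs V)\<^sup>*"
      using path[OF j] rtrancl_mono[OF sub[OF t]] relpow_imp_rtrancl by blast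
    then show ?thesis using t j r_nz \<open>s = i\<close> by blast
  next
    fix l assume l: "p $ l \<noteq> 0" and st: "(s, t) \<in> row_arcs (U l)"
    obtain j where "(l, s) \<in> (row_arcs V)\<^sup>*" "Q $ l $ j \<noteq> 0" "(t, j) \<in> (row_arcs V)\<^sup>*"
      using ret[OF st] rtrancl_mono[OF sub[OF l]] by blast
    then show ?thesis
      using l r_nz first[OF l] by (blast intro: converse_rtrancl_into_rtrancl)
  qed
  moreover have "(i, j) \<in> row_arcs V ^^ Suc k" if "r $ j \<noteq> 0" for j
  proof -
    obtain t where t: "p $ t \<noteq> 0" "Q $ t $ j \<noteq> 0"
      using \<open>r $ j \<noteq> 0\<close> unfolding r_nz by blast
    then have "(t, j) \<in> row_arcs V ^^ k" using path relpow_mono[OF sub] by blast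
    with first[OF t(1)] show ?thesis by (rule relpow_Suc_I2)
  qed
  moreover have "i \<in> fst ` V" by (simp add: V_def)
  ultimately have "unrolls V (Suc k) i r" unfolding unrolls_def by blast
  moreover have "q \<in> row_subdiff f s v" if "(s, q) \<in> V" for s q
    using that p rows by (auto simp: V_def)
  ultimately show ?case by blast
qed

lemma critical_graph_funpow_subset:
  assumes "eigenvector f v" "k \<ge> 1"
  shows "pverts (critical_graph (f ^^ k) v) \<subseteq> pverts (critical_graph f v)"
    and "parcs (critical_graph (f ^^ k) v) \<subseteq> parcs (critical_graph f v) ^^ k"
proof -
  interpret g: convex_monotone_homogeneous "f ^^ k" by (rule funpow_locale)
  obtain R where R: "R \<in> subdifferential (f ^^ k) v"
    and R_arcs: "parcs (critical_graph (f ^^ k) v) \<subseteq> support R"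
    and rec: "\<And>s. s \<in> pverts (critical_graph (f ^^ k) v) \<Longrightarrow> recurrent (support R) s"
    using g.critical_graph_realized by blast
  have "R $ i \<in> row_subdiff (f ^^ k) i v" for i using R by (simp add: subdifferential_iff)
  note row_subdiff_funpow[OF assms(1) this]
  then obtain U where rows: "\<And>i s p. (s, p) \<in> U i \<Longrightarrow> p \<in> row_subdiff f s v"
    and U: "\<And>i. unrolls (U i) k i (R $ i)"
    by metis
  have ret: "(i, s) \<in> (row_arcs (U i))\<^sup>* \<and> (\<exists>j. R $ i $ j \<noteq> 0 \<and> (t, j) \<in> (row_arcs (U i))\<^sup>*)"
    if "(s, t) \<in> row_arcs (U i)" for i s t
    using U[of i] that by (simp add: unrolls_def)
  have path: "(i, j) \<in> row_arcs (U i) ^^ k" if "R $ i $ j \<noteq> 0" for i j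
    using U[of i] that by (simp add: unrolls_def)
  \<comment> \<open>Here \<open>k \<ge> 1\<close> matters: an unrolling of length 0 may use no row
    at \<open>i\<close>.\<close>
  have start: "i \<in> fst ` U i" for i
    using U[of i] assms(2) by (simp add: unrolls_def)
  define V where "V = (\<Union>i\<in>{i. recurrent (support R) i}. U i)"
  have sub: "row_arcs (U i) \<subseteq> row_arcs V" if "recurrent (support R) i" for i
    using that by (intro row_arcs_mono) (auto simp: V_def)
  have lift: "(i, j) \<in> row_arcs V ^^ k" if "recurrent (support R) i" "R $ i $ j \<noteq> 0" for i j
    using path[OF that(2)] relpow_mono[OF sub[OF that(1)]] by blast
  have "\<exists>Q\<in>subdifferential f v. row_arcs V \<subseteq> support Q
    \<and> (\<forall>s\<in>fst ` V. recurrent (support Q) s)"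
  proof (rule recurrent_family)
    show "p \<in> row_subdiff f s v" if "(s, p) \<in> V" for s p
      using that rows by (auto simp: V_def)
    fix s t assume "(s, t) \<in> row_arcs V"
    then obtain i where i: "recurrent (support R) i" "(s, t) \<in> row_arcs (U i)"
      by (auto simp: V_def row_arcs_def)
    then obtain j where j: "(i, s) \<in> (row_arcs V)\<^sup>*" "R $ i $ j \<noteq> 0" "(t, j) \<in> (row_arcs V)\<^sup>*"
      using ret[OF i(2)] rtrancl_mono[OF sub[OF i(1)]] by blast
    \<comment> \<open>The circuit closes as \<open>t\<close> to \<open>j\<close> to \<open>i\<close>
      to \<open>s\<close>; between \<open>j\<close> and \<open>i\<close> each arc of
      \<open>R\<close> is replaced by a path of length \<open>k\<close> in \<open>V\<close>.\<close>
    have "(j, i) \<in> (support R \<inter> {s. recurrent (support R) s} \<times> UNIV)\<^sup>*"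
      using i(1) j(2) by (rule recurrent_support_return)
    moreover have "support R \<inter> {s. recurrent (support R) s} \<times> UNIV \<subseteq> (row_arcs V)\<^sup>*"
      using lift relpow_imp_rtrancl by fastforce
    ultimately have "(j, i) \<in> (row_arcs V)\<^sup>*" using rtrancl_subset_rtrancl by blast
    with j show "(t, s) \<in> (row_arcs V)\<^sup>*" by (meson rtrancl_trans)
  qed
  then obtain Q where Q: "Q \<in> subdifferential f v" "row_arcs V \<subseteq> support Q"
    and recQ: "\<And>s. s \<in> fst ` V \<Longrightarrow> recurrent (support Q) s"
    by blast
  show "pverts (critical_graph (f ^^ k) v) \<subseteq> pverts (critical_graph f v)"
  proof
    fix i assume "i \<in> pverts (critical_graph (f ^^ k) v)"
    then have "i \<in> fst ` V" using rec start[of i] by (force simp: V_def)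
    then show "i \<in> pverts (critical_graph f v)"
      using Q(1) recQ by (auto simp: pverts_critical_graph)
  qed
  have crit: "row_arcs V \<subseteq> parcs (critical_graph f v)"
  proof safe
    fix s t assume st: "(s, t) \<in> row_arcs V"
    then have "s \<in> fst ` V" by (force simp: row_arcs_def)
    moreover have "Q $ s $ t \<noteq> 0" using st Q(2) by auto
    ultimately show "(s, t) \<in> parcs (critical_graph f v)"
      using Q(1) recQ unfolding parcs_critical_graph by blast
  qed
  show "parcs (critical_graph (f ^^ k) v) \<subseteq> parcs (critical_graph f v) ^^ k"
  proof safe
    fix i j assume ij: "(i, j) \<in> parcs (critical_graph (f ^^ k) v)"
    then have "recurrent (support R) i" using rec parcs_critical_graph_subset by blast
    moreover have "R $ i $ j \<noteq> 0" using ij R_arcs by auto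
    ultimately show "(i, j) \<in> parcs (critical_graph f v) ^^ k"
      using lift relpow_mono[OF crit] by blast
  qed
qed

end

theorem theorem4p1:
  fixes f :: "real^'n \<Rightarrow> real^'n" and v w :: "real^'n" and k :: nat
  assumes "coordinatewise_convex f" and "mono f" and "additively_homogeneous f"
    and "eigenvector f v"
    and "k \<ge> 1"
    and "eigenvector (f ^^ k) w"
  shows "critical_graph (f ^^ k) w = graph_power (critical_graph f v) k
    \<and> critical_nodes (f ^^ k) w = critical_nodes f v"
proof -
  interpret convex_monotone_homogeneous f using assms(1-3) by unfold_locales
  interpret g: convex_monotone_homogeneous "f ^^ k" by (rule funpow_locale)
  \<comment> \<open>\<open>w\<close> may fail to be an eigenvector of \<open>f\<close>, so the
    argument passes to \<open>v\<close>, an eigenvector of both maps.\<close>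
  have "critical_graph (f ^^ k) w = critical_graph (f ^^ k) v"
    using assms(6) eigenvector_funpow[OF assms(3,4)] by (rule g.critical_graph_eigenvector_independent)
  also have "\<dots> = graph_power (critical_graph f v) k"
    using graph_power_subset[OF assms(4,5)] critical_graph_funpow_subset[OF assms(4,5)]
    by (intro pair_pre_digraph.equality)
      (auto simp: parcs_graph_power[OF parcs_critical_graph_subset assms(5)])
  finally show ?thesis by simp
qed

end
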